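(* Let $G$ be a finite, simple, undirected, connected graph such that $\operatorname{girth}(G) \geq 5$ and such that every vertex of $G$ is either a cut vertex or lies in a cycle of $G$. Then $G$ is not distance preserving.
   Context: All graphs are finite, undirected, simple, and connected. The girth of a graph $G$, denoted $\operatorname{girth}(G)$, is the smallest length (number of edges) of a cycle in $G$. The distance $d_G(u,v)$ is the minimal length (number of edges) of a path in $G$ connecting $u$ and $v$. An induced subgraph $H$ of $G$ is called an isometric subgraph of $G$ if $d_H(a,b)=d_G(a,b)$ for every pair of vertices $a,b\in V(H)$ (in particular, since $G$ is connected, an isometric subgraph is connected). A connected graph $G$ is called distance preserving (dp) if and only if it has an isometric subgraph with exactly $i$ vertices for every $1\le i\le |V(G)|$. *)

theory Defs
  imports "Graph_Theory.Graph_Theory" "HOL-Library.Extended_Nat"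
begin

text \<open>
  Finite simple undirected graphs are the symmetric digraphs of the locale \<open>graph\<close>: an edge
  between \<open>u\<close> and \<open>v\<close> is the pair of arcs from \<open>u\<close> to \<open>v\<close> and from \<open>v\<close> to \<open>u\<close>. An arc path traverses
  each edge in one direction, so its length is its number of edges.
\<close>

text \<open>The value is \<open>\<infinity>\<close> if there is no path from \<open>u\<close> to \<open>v\<close>.\<close>

definition graph_dist :: "('a, 'b) pre_digraph \<Rightarrow> 'a \<Rightarrow> 'a \<Rightarrow> enat" where
  "graph_dist G u v = (INF p\<in>{p. pre_digraph.apath G u p v}. enat (length p))"

text \<open>
  The library's directed cycles include those of length 2 that traverse an edge back and forth;
  these are not cycles of the undirected graph. In a graph without loops and parallel arcs, the
  directed cycles of length at least 3 are exactly the cycles of the undirected graph, with a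
  starting vertex and an orientation.
\<close>

definition undirected_cycle :: "('a, 'b) pre_digraph \<Rightarrow> 'b list \<Rightarrow> bool" where
  "undirected_cycle G p \<longleftrightarrow> pre_digraph.cycle G p \<and> 3 \<le> length p"

text \<open>The girth of a forest is \<open>\<infinity>\<close>.\<close>

definition girth :: "('a, 'b) pre_digraph \<Rightarrow> enat" where
  "girth G = (INF p\<in>{p. undirected_cycle G p}. enat (length p))"

definition lies_in_cycle :: "('a, 'b) pre_digraph \<Rightarrow> 'a \<Rightarrow> bool" where
  "lies_in_cycle G v \<longleftrightarrow> (\<exists>p. undirected_cycle G p \<and> v \<in> tail G ` set p)"

text \<open>
  The negation of the library's \<open>connected\<close> is not used for the graph without \<open>v\<close>: the empty graph
  is not \<open>connected\<close>, but the only vertex of a one-vertex graph is not a cut vertex.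
\<close>

definition cut_vertex :: "('a, 'b) pre_digraph \<Rightarrow> 'a \<Rightarrow> bool" where
  "cut_vertex G v \<longleftrightarrow> v \<in> verts G \<and>
     (\<exists>a \<in> verts G - {v}. \<exists>b \<in> verts G - {v}.
        a \<rightarrow>\<^sup>*\<^bsub>G\<^esub> b \<and> \<not> a \<rightarrow>\<^sup>*\<^bsub>pre_digraph.del_vert G v\<^esub> b)"

definition isometric_subgraph :: "('a, 'b) pre_digraph \<Rightarrow> ('a, 'b) pre_digraph \<Rightarrow> bool" where
  "isometric_subgraph H G \<longleftrightarrow> induced_subgraph H G \<and>
     (\<forall>a \<in> verts H. \<forall>b \<in> verts H. graph_dist H a b = graph_dist G a b)"

definition distance_preserving :: "('a, 'b) pre_digraph \<Rightarrow> bool" where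
  "distance_preserving G \<longleftrightarrow>
     (\<forall>i. 1 \<le> i \<and> i \<le> card (verts G) \<longrightarrow> (\<exists>H. isometric_subgraph H G \<and> card (verts H) = i))"

end

theory Submission
  imports Defs
begin

text \<open>
  No isometric subgraph omits exactly one vertex \<open>v\<close>. If \<open>v\<close> is a cut vertex, \<open>G - v\<close> is disconnected.
  If \<open>v\<close> lies on a cycle, let \<open>x\<close> and \<open>y\<close> be its neighbours on the cycle: girth at least 5 excludes
  an edge \<open>xy\<close> and a second common neighbour, so their distance is 2 in \<open>G\<close> but larger in \<open>G - v\<close>.
\<close>

lemma graph_dist_less_iff:
  "graph_dist G u v < enat n \<longleftrightarrow> (\<exists>p. pre_digraph.apath G u p v \<and> length p < n)"
  by (auto simp: graph_dist_def INF_less_iff)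

text \<open>Turns equality of distances into preservation of reachability, which is what the cut
  vertex case uses.\<close>

lemma (in wf_digraph) graph_dist_finite_iff: "graph_dist G u v < \<infinity> \<longleftrightarrow> u \<rightarrow>\<^sup>* v"
  unfolding graph_dist_def INF_less_iff reachable_apath by simp

lemma girth_le_length:
  assumes "pre_digraph.cycle G p" "3 \<le> length p"
  shows "girth G \<le> enat (length p)"
  unfolding girth_def using assms by (intro INF_lower) (auto simp: undirected_cycle_def)

text \<open>With girth at least 5, this forbids an edge between two neighbours of a vertex.
  Distinctness of the vertices makes the closed walk based at \<open>a\<close> a cycle.\<close>

lemma (in wf_digraph) girth_le_3:
  assumes "a \<rightarrow>\<^bsub>G\<^esub> b" "b \<rightarrow>\<^bsub>G\<^esub> c" "c \<rightarrow>\<^bsub>G\<^esub> a" "distinct [a, b, c]"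
  shows "girth G \<le> 3"
proof -
  obtain e f g where
    "e \<in> arcs G" "tail G e = a" "head G e = b" "f \<in> arcs G" "tail G f = b" "head G f = c"
    "g \<in> arcs G" "tail G g = c" "head G g = a"
    using assms(1-3) by (auto simp: arcs_ends_conv)
  then have "cycle [e, f, g]"
    using assms(4) unfolding cycle_def by (intro exI[of _ a]) (auto simp: awalk_simps)
  from girth_le_length[OF this] show ?thesis by (simp add: numeral_eq_enat numeral_eq_Suc)
qed

text \<open>With girth at least 5, this forbids a second common neighbour of two vertices.\<close>

lemma (in wf_digraph) girth_le_4:
  assumes "a \<rightarrow>\<^bsub>G\<^esub> b" "b \<rightarrow>\<^bsub>G\<^esub> c" "c \<rightarrow>\<^bsub>G\<^esub> d" "d \<rightarrow>\<^bsub>G\<^esub> a" "distinct [a, b, c, d]"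
  shows "girth G \<le> 4"
proof -
  obtain e f g h where
    "e \<in> arcs G" "tail G e = a" "head G e = b" "f \<in> arcs G" "tail G f = b" "head G f = c"
    "g \<in> arcs G" "tail G g = c" "head G g = d" "h \<in> arcs G" "tail G h = d" "head G h = a"
    using assms(1-4) by (auto simp: arcs_ends_conv)
  then have "cycle [e, f, g, h]"
    using assms(5) unfolding cycle_def by (intro exI[of _ a]) (auto simp: awalk_simps)
  from girth_le_length[OF this] show ?thesis by (simp add: numeral_eq_enat numeral_eq_Suc)
qed

text \<open>Rotate the cycle so that it starts at \<open>v\<close> with the arc \<open>e\<close>.
  Then \<open>y\<close> is the head of \<open>e\<close> and \<open>x\<close> the head of the last
  arc but one; these are different arcs because the cycle has length at least 3.\<close>

lemma (in wf_digraph) lies_in_cycle_two_neighbours: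
  assumes "lies_in_cycle G v"
  obtains x y where "x \<rightarrow>\<^bsub>G\<^esub> v" "v \<rightarrow>\<^bsub>G\<^esub> y" "x \<noteq> y"
proof -
  from assms obtain p u e where p: "awalk u p u" "distinct (tl (awalk_verts u p))"
    "3 \<le> length p" "e \<in> set p" "tail G e = v"
    unfolding lies_in_cycle_def undirected_cycle_def cycle_def by auto
  from p(4) obtain q r where q: "p = q @ e # r" by (auto simp: in_set_conv_decomp)
  from p(1) have "cas u p u" by (simp add: awalk_def)
  \<comment> \<open>The vertices of the walk after its start are the heads of its arcs, and
    distinctness of the heads survives rotation.\<close>
  then have "distinct (map (head G) p)"
    using p(2,3) by (auto simp: awalk_verts_conv' split: if_splits)
  then have dist: "distinct (map (head G) (e # r @ q))" unfolding q by auto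
  have walk: "awalk v (e # r @ q) v"
    using p(1,5) unfolding q by (auto simp: awalk_Cons_iff)
  obtain s f where s: "r @ q = s @ [f]" "s \<noteq> []"
  proof (cases "r @ q" rule: rev_cases)
    case Nil
    then show ?thesis using p(3) q by auto
  next
    case (snoc s f)
    then have "length r + length q = Suc (length s)" by (metis length_append length_append_singleton)
    then have "s \<noteq> []" using p(3) q by auto
    then show ?thesis using snoc that by blast
  qed
  then obtain t g where t: "s = t @ [g]" by (metis rev_exhaust)
  have f: "f \<in> arcs G" "head G f = v" "tail G f = head G g" "e \<in> arcs G"
    using walk s t by (auto simp: awalk_Cons_iff)
  \<comment> \<open>The rotated cycle is \<open>e # t @ [g, f]\<close>, so \<open>g\<close> and
    \<open>e\<close> stand at different positions.\<close>
  moreover have "head G g \<noteq> head G e" using dist s t by auto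
  ultimately show ?thesis using that[of "head G g" "head G e"] p(5)
    by (metis in_arcs_imp_in_arcs_ends)
qed

lemma (in wf_digraph) not_isometric_del_cut_vertex:
  assumes "cut_vertex G v" "verts H = verts G - {v}"
  shows "\<not> isometric_subgraph H G"
proof
  assume iso: "isometric_subgraph H G"
  then have ind: "induced_subgraph H G" by (simp add: isometric_subgraph_def)
  interpret H: wf_digraph H using ind by (rule wf_digraphI_induced)
  from assms obtain a b where ab: "a \<in> verts H" "b \<in> verts H" "a \<rightarrow>\<^sup>* b"
    "\<not> a \<rightarrow>\<^sup>*\<^bsub>del_vert v\<^esub> b"
    by (auto simp: cut_vertex_def)
  have "graph_dist H a b < \<infinity>"
    using ab iso graph_dist_finite_iff by (simp add: isometric_subgraph_def)
  then have reach: "a \<rightarrow>\<^sup>*\<^bsub>H\<^esub> b" by (simp only: H.graph_dist_finite_iff)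
  have "arcs H = {e \<in> arcs G. tail G e \<in> verts H \<and> head G e \<in> verts H}"
    using ind by (simp only: induced_subgraph_def)
  then have "arcs H = arcs (del_vert v)"
    unfolding arcs_del_vert assms(2) using wellformed by blast
  moreover have "tail H = tail G" "head H = head G"
    using ind unfolding induced_subgraph_def subgraph_def compatible_def by metis+
  \<comment> \<open>Reachability depends only on the vertex set and \<open>arcs_ends\<close>, so
    agreement of these suffices.\<close>
  ultimately have "arcs_ends H = arcs_ends (del_vert v)"
    by (simp only: arcs_ends_conv tail_del_vert head_del_vert)
  with reach have "a \<rightarrow>\<^sup>*\<^bsub>del_vert v\<^esub> b"
    unfolding reachable_def verts_del_vert assms(2) by simp
  with ab(4) show False by contradiction
qed

lemma (in graph) not_isometric_del_cycle_vertex: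
  assumes "lies_in_cycle G v" "girth G \<ge> 5" "verts H = verts G - {v}"
  shows "\<not> isometric_subgraph H G"
proof
  assume iso: "isometric_subgraph H G"
  then have ind: "induced_subgraph H G" by (simp add: isometric_subgraph_def)
  interpret H: wf_digraph H using ind by (rule wf_digraphI_induced)
  have sub: "arcs_ends H \<subseteq> arcs_ends G"
    using ind by (intro arcs_ends_mono induced_imp_subgraph)
  obtain x y where xy: "x \<rightarrow>\<^bsub>G\<^esub> v" "v \<rightarrow>\<^bsub>G\<^esub> y" "x \<noteq> y"
    using assms(1) by (rule lies_in_cycle_two_neighbours)
  then have ne: "x \<noteq> v" "v \<noteq> y" by (auto dest: adj_not_same)
  have xyH: "x \<in> verts H" "y \<in> verts H" using xy ne assms(3) by (auto dest: adj_in_verts)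
  have yx: "y \<rightarrow>\<^bsub>G\<^esub> v" "v \<rightarrow>\<^bsub>G\<^esub> x" using xy sym_arcs unfolding symmetric_def by (auto dest: symD)
  obtain e f where "e \<in> arcs G" "tail G e = x" "head G e = v" "f \<in> arcs G" "tail G f = v" "head G f = y"
    using xy by (auto simp: arcs_ends_conv)
  then have "apath x [e, f] y" using xy(3) ne by (auto simp: apath_Cons_iff apath_Nil_iff)
  \<comment> \<open>The path through \<open>v\<close> has two arcs. Isometry carries this bound to
    \<open>H\<close>, which avoids \<open>v\<close>.\<close>
  then have "graph_dist G x y < enat 3" unfolding graph_dist_less_iff by force
  then have "graph_dist H x y < enat 3" using iso xyH by (simp add: isometric_subgraph_def)
  then obtain p where p: "H.apath x p y" "length p < 3" unfolding graph_dist_less_iff by blast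
  \<comment> \<open>A path with at most two arcs is an edge or has one inner vertex
    \<open>w\<close>, since \<open>x \<noteq> y\<close> rules out the empty path.\<close>
  have "x \<rightarrow>\<^bsub>H\<^esub> y \<or> (\<exists>w. x \<rightarrow>\<^bsub>H\<^esub> w \<and> w \<rightarrow>\<^bsub>H\<^esub> y \<and> x \<noteq> w \<and> w \<noteq> y)"
  proof (cases p)
    case Nil
    then show ?thesis using p xy(3) by (simp add: H.apath_Nil_iff)
  next
    case (Cons g q)
    show ?thesis
    proof (cases q)
      case Nil
      then show ?thesis using p Cons
        by (auto simp: H.apath_Cons_iff H.apath_Nil_iff dest: H.in_arcs_imp_in_arcs_ends)
    next
      case (Cons h r)
      then show ?thesis using p \<open>p = g # q\<close>
        by (intro disjI2 exI[of _ "head H g"])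
          (auto simp: H.apath_Cons_iff H.apath_Nil_iff dest: H.in_arcs_imp_in_arcs_ends)
    qed
  qed
  then show False
  proof (elim disjE exE conjE)
    assume "x \<rightarrow>\<^bsub>H\<^esub> y"
    then have "girth G \<le> 3" using girth_le_3[of x y v] yx xy ne sub by auto
    from order_trans[OF assms(2) this] show False by simp
  next
    fix w assume w: "x \<rightarrow>\<^bsub>H\<^esub> w" "w \<rightarrow>\<^bsub>H\<^esub> y" "x \<noteq> w" "w \<noteq> y"
    \<comment> \<open>As a vertex of \<open>H\<close>, \<open>w\<close> differs from
      \<open>v\<close>, so \<open>x\<close>, \<open>w\<close>, \<open>y\<close>, \<open>v\<close>
      form a genuine 4-cycle.\<close>
    then have "w \<noteq> v" using assms(3) H.wellformed by (auto simp: arcs_ends_conv)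
    then have "girth G \<le> 4" using girth_le_4[of x w y v] w yx xy ne sub by auto
    from order_trans[OF assms(2) this] show False by simp
  qed
qed

theorem theorem4p1:
  fixes G :: "('a, 'b) pre_digraph"
  assumes "graph G"
    and "Digraph_Component.connected G"
    and "girth G \<ge> 5"
    and "\<forall>v \<in> verts G. cut_vertex G v \<or> lies_in_cycle G v"
  shows "\<not> distance_preserving G"
proof
  assume dp: "distance_preserving G"
  interpret graph G by fact
  obtain v where v: "v \<in> verts G"
    using assms(2) by (auto simp: connected_def strongly_connected_def)
  \<comment> \<open>Distance preservation speaks only of sizes from 1 on; a second vertex makes the
    size \<open>card (verts G) - 1\<close> admissible.\<close>
  have "\<exists>w \<in> verts G. w \<noteq> v"
  proof (cases "cut_vertex G v")
    case True
    then show ?thesis by (auto simp: cut_vertex_def)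
  next
    case False
    then have "lies_in_cycle G v" using assms(4) v by blast
    then obtain x y where "x \<rightarrow>\<^bsub>G\<^esub> v" "v \<rightarrow>\<^bsub>G\<^esub> y" "x \<noteq> y" by (rule lies_in_cycle_two_neighbours)
    then show ?thesis by (metis adj_in_verts)
  qed
  then obtain w where w: "w \<in> verts G" "w \<noteq> v" by blast
  have "card {v, w} \<le> card (verts G)" using v w by (intro card_mono) auto
  then have card: "2 \<le> card (verts G)" using w by auto
  then have "1 \<le> card (verts G) - 1 \<and> card (verts G) - 1 \<le> card (verts G)" by linarith
  then obtain H where H: "isometric_subgraph H G" "card (verts H) = card (verts G) - 1"
    using dp unfolding distance_preserving_def by blast
  then have sub: "verts H \<subseteq> verts G"
    by (auto simp: isometric_subgraph_def induced_subgraph_def subgraph_def)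
  \<comment> \<open>The subgraph of this size omits a single vertex \<open>u\<close>, and either
    alternative for \<open>u\<close> contradicts its isometry.\<close>
  then have "card (verts G - verts H) = 1"
    using H(2) card by (simp add: card_Diff_subset finite_subset)
  then obtain u where "verts G - verts H = {u}" by (auto simp: card_1_singleton_iff)
  then have "u \<in> verts G" "verts H = verts G - {u}" using sub by auto
  then show False
    using assms(3,4) H(1) not_isometric_del_cut_vertex not_isometric_del_cycle_vertex by blast
qed

end
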